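(* Let $L$ be the complex Lie superalgebra generated by two odd elements $\hat{x}$ and $\hat{p}$ subject to the relations $$[\{\hat{x},\hat{p}\},\hat{x}] = -2i\,\hat{x}, \qquad [\{\hat{x},\hat{p}\},\hat{p}] = 2i\,\hat{p}.$$ Then $L$ is the Lie superalgebra $\mathfrak{osp}(1|2)$.
   Context: Here $i$ is the imaginary unit; $\{\cdot,\cdot\}$ denotes the anticommutator, i.e. the Lie superbracket of two odd elements ($\{X,Y\}=XY+YX$ in an enveloping associative algebra), and $[\cdot,\cdot]$ denotes the commutator, i.e. the Lie superbracket of an even element with any element. No relation of the form $[\hat x,\hat p]=i$ is assumed. $\mathfrak{osp}(1|2)$ is the (five-dimensional) orthosymplectic complex Lie superalgebra; it is described as the Lie superalgebra generated by two odd elements $b^+$, $b^-$ with the defining relations $[\{b^-,b^+\},b^{\pm}] = \pm 2 b^{\pm}$. Its even part is spanned by $h=\frac12\{b^+,b^-\}$, $e=\frac12 (b^+)^2$, $f=-\frac12 (b^-)^2$ (where $(b^\pm)^2=\frac12\{b^\pm,b^\pm\}$), with $[h,e]=2e$, $[h,f]=-2f$, $[e,f]=h$. *)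

theory Defs
  imports "HOL-Analysis.Analysis" "HOL-Library.Z2"
begin

section \<open>Complex Lie superalgebras\<close>

text \<open>
  Parities are elements of the type \<^typ>\<open>bit\<close>, that is, of the field with two elements. A
  superalgebra lives on a subspace of an ambient complex vector space: \<open>part A 0\<close> and \<open>part A 1\<close>
  are its even and odd subspaces, and its underlying space is their sum. Nothing is required of
  the bracket outside this sum.
\<close>

record 'a superalgebra =
  scl :: "complex \<Rightarrow> 'a \<Rightarrow> 'a"
  part :: "bit \<Rightarrow> 'a set"
  brk :: "'a \<Rightarrow> 'a \<Rightarrow> 'a"

definition car :: "'a::ab_group_add superalgebra \<Rightarrow> 'a set" where
  "car A = {x + y | x y. x \<in> part A 0 \<and> y \<in> part A 1}"

definition koszul :: "bit \<Rightarrow> bit \<Rightarrow> complex" where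
  "koszul a b = (if a = 1 \<and> b = 1 then - 1 else 1)"

locale lie_superalgebra =
  fixes A :: "'a::ab_group_add superalgebra"
  assumes vector_space_scl: "vector_space (scl A)"
    and subspace_part: "module.subspace (scl A) (part A a)"
    and part_Int: "part A 0 \<inter> part A 1 = {0}"
    and brk_add_left:
      "\<lbrakk>x \<in> car A; y \<in> car A; z \<in> car A\<rbrakk> \<Longrightarrow> brk A (x + y) z = brk A x z + brk A y z"
    and brk_add_right:
      "\<lbrakk>x \<in> car A; y \<in> car A; z \<in> car A\<rbrakk> \<Longrightarrow> brk A x (y + z) = brk A x y + brk A x z"
    and brk_scl_left:
      "\<lbrakk>x \<in> car A; y \<in> car A\<rbrakk> \<Longrightarrow> brk A (scl A c x) y = scl A c (brk A x y)"
    and brk_scl_right: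
      "\<lbrakk>x \<in> car A; y \<in> car A\<rbrakk> \<Longrightarrow> brk A x (scl A c y) = scl A c (brk A x y)"
    and brk_part:
      "\<lbrakk>x \<in> part A a; y \<in> part A b\<rbrakk> \<Longrightarrow> brk A x y \<in> part A (a + b)"
    and brk_skew:
      "\<lbrakk>x \<in> part A a; y \<in> part A b\<rbrakk> \<Longrightarrow> brk A x y = - scl A (koszul a b) (brk A y x)"
    and brk_jacobi:
      "\<lbrakk>x \<in> part A a; y \<in> part A b; z \<in> part A d\<rbrakk> \<Longrightarrow>
        brk A x (brk A y z) = brk A (brk A x y) z + scl A (koszul a b) (brk A y (brk A x z))"

definition lie_superalgebra_iso ::
  "'a::ab_group_add superalgebra \<Rightarrow> 'b::ab_group_add superalgebra \<Rightarrow> ('a \<Rightarrow> 'b) \<Rightarrow> bool" where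
  "lie_superalgebra_iso A B \<phi> \<longleftrightarrow>
    bij_betw \<phi> (car A) (car B) \<and>
    (\<forall>a. \<phi> ` part A a = part B a) \<and>
    (\<forall>x\<in>car A. \<forall>y\<in>car A. \<phi> (x + y) = \<phi> x + \<phi> y) \<and>
    (\<forall>c. \<forall>x\<in>car A. \<phi> (scl A c x) = scl B c (\<phi> x)) \<and>
    (\<forall>x\<in>car A. \<forall>y\<in>car A. \<phi> (brk A x y) = brk B (\<phi> x) (\<phi> y))"

definition isomorphic_lie_superalgebras ::
  "'a::ab_group_add superalgebra \<Rightarrow> 'b::ab_group_add superalgebra \<Rightarrow> bool" where
  "isomorphic_lie_superalgebras A B \<longleftrightarrow>
    lie_superalgebra A \<and> lie_superalgebra B \<and> (\<exists>\<phi>. lie_superalgebra_iso A B \<phi>)"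

section \<open>Generators and relations\<close>

text \<open>
  The Lie superalgebra with generators in \<open>'g\<close>, of prescribed parities, and relations \<open>R\<close> is the
  algebra of formal expressions modulo the smallest congruence that contains \<open>R\<close> and satisfies
  the laws of a Lie superalgebra. Skew-symmetry and the Jacobi identity are imposed on
  homogeneous expressions; by bilinearity this determines them on all expressions.
\<close>

datatype 'g lterm =
    Gen 'g
  | Zero
  | Add "'g lterm" "'g lterm"
  | Scale complex "'g lterm"
  | Br "'g lterm" "'g lterm"

inductive homog :: "('g \<Rightarrow> bit) \<Rightarrow> bit \<Rightarrow> 'g lterm \<Rightarrow> bool" for gpar where
  homog_Gen: "homog gpar (gpar g) (Gen g)"
| homog_Zero: "homog gpar a Zero"
| homog_Add: "homog gpar a s \<Longrightarrow> homog gpar a t \<Longrightarrow> homog gpar a (Add s t)"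
| homog_Scale: "homog gpar a t \<Longrightarrow> homog gpar a (Scale c t)"
| homog_Br: "homog gpar a s \<Longrightarrow> homog gpar b t \<Longrightarrow> homog gpar (a + b) (Br s t)"

inductive lie_eq ::
  "('g \<Rightarrow> bit) \<Rightarrow> ('g lterm \<times> 'g lterm) set \<Rightarrow> 'g lterm \<Rightarrow> 'g lterm \<Rightarrow> bool"
  for gpar R where
  relation: "(s, t) \<in> R \<Longrightarrow> lie_eq gpar R s t"
| refl: "lie_eq gpar R t t"
| sym: "lie_eq gpar R s t \<Longrightarrow> lie_eq gpar R t s"
| trans: "lie_eq gpar R s t \<Longrightarrow> lie_eq gpar R t u \<Longrightarrow> lie_eq gpar R s u"
| cong_Add: "lie_eq gpar R s s' \<Longrightarrow> lie_eq gpar R t t' \<Longrightarrow> lie_eq gpar R (Add s t) (Add s' t')"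
| cong_Scale: "lie_eq gpar R t t' \<Longrightarrow> lie_eq gpar R (Scale c t) (Scale c t')"
| cong_Br: "lie_eq gpar R s s' \<Longrightarrow> lie_eq gpar R t t' \<Longrightarrow> lie_eq gpar R (Br s t) (Br s' t')"
| add_assoc: "lie_eq gpar R (Add (Add s t) u) (Add s (Add t u))"
| add_comm: "lie_eq gpar R (Add s t) (Add t s)"
| add_zero: "lie_eq gpar R (Add Zero t) t"
| add_inverse: "lie_eq gpar R (Add (Scale (- 1) t) t) Zero"
| scale_one: "lie_eq gpar R (Scale 1 t) t"
| scale_scale: "lie_eq gpar R (Scale c (Scale d t)) (Scale (c * d) t)"
| scale_add_left: "lie_eq gpar R (Scale (c + d) t) (Add (Scale c t) (Scale d t))"
| scale_add_right: "lie_eq gpar R (Scale c (Add s t)) (Add (Scale c s) (Scale c t))"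
| br_add_left: "lie_eq gpar R (Br (Add s t) u) (Add (Br s u) (Br t u))"
| br_add_right: "lie_eq gpar R (Br s (Add t u)) (Add (Br s t) (Br s u))"
| br_scale_left: "lie_eq gpar R (Br (Scale c s) t) (Scale c (Br s t))"
| br_scale_right: "lie_eq gpar R (Br s (Scale c t)) (Scale c (Br s t))"
| skew: "homog gpar a s \<Longrightarrow> homog gpar b t \<Longrightarrow>
    lie_eq gpar R (Br s t) (Scale (- koszul a b) (Br t s))"
| jacobi: "homog gpar a s \<Longrightarrow> homog gpar b t \<Longrightarrow> homog gpar d u \<Longrightarrow>
    lie_eq gpar R (Br s (Br t u)) (Add (Br (Br s t) u) (Scale (koszul a b) (Br t (Br s u))))"

lemma equivp_lie_eq: "equivp (lie_eq gpar R)"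
  by (rule equivpI)
    (auto intro!: reflpI sympI transpI intro: lie_eq.refl lie_eq.sym lie_eq.trans)

section \<open>The Lie superalgebra generated by the position and momentum operators\<close>

datatype xp = X | P

text \<open>
  Both generators are odd, so \<open>Br (Gen X) (Gen P)\<close> is the anticommutator \<open>{x, p}\<close>, which is even,
  and its bracket with a generator is a commutator.
\<close>

definition xp_parity :: "xp \<Rightarrow> bit" where
  "xp_parity g = 1"

definition xp_relations :: "(xp lterm \<times> xp lterm) set" where
  "xp_relations =
    {(Br (Br (Gen X) (Gen P)) (Gen X), Scale (- 2 * \<i>) (Gen X)),
     (Br (Br (Gen X) (Gen P)) (Gen P), Scale (2 * \<i>) (Gen P))}"

quotient_type xp_carrier = "xp lterm" / "lie_eq xp_parity xp_relations"
  by (rule equivp_lie_eq)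

instantiation xp_carrier :: ab_group_add
begin

lift_definition zero_xp_carrier :: xp_carrier is Zero .

lift_definition plus_xp_carrier :: "xp_carrier \<Rightarrow> xp_carrier \<Rightarrow> xp_carrier" is Add
  by (rule lie_eq.cong_Add)

lift_definition uminus_xp_carrier :: "xp_carrier \<Rightarrow> xp_carrier" is "Scale (- 1)"
  by (rule lie_eq.cong_Scale)

definition minus_xp_carrier :: "xp_carrier \<Rightarrow> xp_carrier \<Rightarrow> xp_carrier" where
  "minus_xp_carrier x y = x + - y"

instance
proof
  fix x y z :: xp_carrier
  show "x + y + z = x + (y + z)" by transfer (rule lie_eq.add_assoc)
  show "x + y = y + x" by transfer (rule lie_eq.add_comm)
  show "0 + x = x" by transfer (rule lie_eq.add_zero)
  show "- x + x = 0" by transfer (rule lie_eq.add_inverse)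
  show "x - y = x + - y" by (rule minus_xp_carrier_def)
qed

end

lift_definition xp_scale :: "complex \<Rightarrow> xp_carrier \<Rightarrow> xp_carrier" is Scale
  by (rule lie_eq.cong_Scale)

lift_definition xp_bracket :: "xp_carrier \<Rightarrow> xp_carrier \<Rightarrow> xp_carrier" is Br
  by (rule lie_eq.cong_Br)

definition xp_superalgebra :: "xp_carrier superalgebra" where
  "xp_superalgebra =
    \<lparr>scl = xp_scale,
     part = (\<lambda>a. abs_xp_carrier ` {t. homog xp_parity a t}),
     brk = xp_bracket\<rparr>"

section \<open>The orthosymplectic Lie superalgebra osp(1|2)\<close>

text \<open>
  Matrices in \<open>gl(m|n)\<close> are indexed by a disjoint sum, whose left summand indexes the even
  coordinates and whose right summand the odd ones. In the type \<open>1 + 2\<close> the even index is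
  \<open>Inl 0\<close> and the odd indices are \<open>Inr 0\<close> and \<open>Inr 1\<close>.
\<close>

fun index_parity :: "'m + 'n \<Rightarrow> bit" where
  "index_parity (Inl i) = 0"
| "index_parity (Inr j) = 1"

definition vec_part :: "bit \<Rightarrow> (complex ^ ('m::finite + 'n::finite)) set" where
  "vec_part a = {v. \<forall>i. v $ i \<noteq> 0 \<longrightarrow> index_parity i = a}"

definition mat_component ::
  "bit \<Rightarrow> complex ^ ('m + 'n) ^ ('m + 'n) \<Rightarrow> complex ^ ('m::finite + 'n::finite) ^ ('m + 'n)" where
  "mat_component a M = (\<chi> i j. if index_parity i + index_parity j = a then M $ i $ j else 0)"

definition gl_part :: "bit \<Rightarrow> (complex ^ ('m::finite + 'n::finite) ^ ('m + 'n)) set" where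
  "gl_part a = {M. \<forall>i j. M $ i $ j \<noteq> 0 \<longrightarrow> index_parity i + index_parity j = a}"

text \<open>The bilinear extension of \<open>M N - (-1)\<^sup>a\<^sup>b N M\<close> for \<open>M\<close>, \<open>N\<close> homogeneous of parity \<open>a\<close>, \<open>b\<close>.\<close>

definition supercommutator ::
  "complex ^ ('m + 'n) ^ ('m + 'n) \<Rightarrow> complex ^ ('m + 'n) ^ ('m + 'n)
    \<Rightarrow> complex ^ ('m::finite + 'n::finite) ^ ('m + 'n)" where
  "supercommutator M N =
    (\<Sum>a\<in>{0, 1}. \<Sum>b\<in>{0, 1}.
      mat_component a M ** mat_component b N
      - map_matrix ((*) (koszul a b)) (mat_component b N ** mat_component a M))"

text \<open>
  The standard even nondegenerate supersymmetric form on \<open>\<complex>\<^sup>1\<^sup>|\<^sup>2\<close>: the even and odd coordinates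
  are orthogonal, and the form is symmetric on the former and skew-symmetric on the latter.
\<close>

definition osp12_form :: "complex ^ (1 + 2) \<Rightarrow> complex ^ (1 + 2) \<Rightarrow> complex" where
  "osp12_form v w =
    v $ Inl 0 * w $ Inl 0 + v $ Inr 0 * w $ Inr 1 - v $ Inr 1 * w $ Inr 0"

definition osp12_part :: "bit \<Rightarrow> (complex ^ (1 + 2) ^ (1 + 2)) set" where
  "osp12_part a =
    {M \<in> gl_part a. \<forall>b. \<forall>v \<in> vec_part b. \<forall>w.
      osp12_form (M *v v) w + koszul a b * osp12_form v (M *v w) = 0}"

definition osp12 :: "(complex ^ (1 + 2) ^ (1 + 2)) superalgebra" where
  "osp12 =
    \<lparr>scl = (\<lambda>c. map_matrix ((*) c)),
     part = osp12_part,
     brk = supercommutator\<rparr>"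

end

theory Submission
  imports Defs
begin

text \<open>
  The matrices of osp(1|2) satisfy the two relations for suitable odd elements \<open>x\<close> and \<open>p\<close>, so
  evaluation of expressions induces a homomorphism onto osp(1|2). Conversely, the Jacobi identity
  and skew-symmetry give \<open>[x,[x,x]] = 0\<close> and \<open>[u,[v,v]] = 2[[u,v],v]\<close> for odd \<open>u\<close>, \<open>v\<close>, so that the
  relations make the span of \<open>x\<close>, \<open>p\<close>, \<open>[x,x]\<close>, \<open>[x,p]\<close>, \<open>[p,p]\<close> stable under bracketing with \<open>x\<close>
  and \<open>p\<close>; hence it is everything. Since the images of these five elements are linearly
  independent, the homomorphism is injective. Only this injectivity shows that the even and odd
  parts of the presented algebra meet in zero.
\<close>

section \<open>The general linear Lie superalgebra\<close>

lemma koszul_simps [simp]: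
  "koszul 0 b = 1" "koszul a 0 = 1" "koszul 1 1 = - 1"
  by (simp_all add: koszul_def)

lemma map_matrix_one [simp]: "map_matrix ((*) (1::complex)) M = M"
  by (simp add: vec_eq_iff)

lemma map_matrix_minus [simp]: "map_matrix ((*) (- c::complex)) M = - map_matrix ((*) c) M"
  by (simp add: vec_eq_iff)

lemma map_matrix_zero [simp]: "map_matrix ((*) (c::complex)) 0 = 0"
  by (simp add: vec_eq_iff)

lemma map_matrix_add:
  "map_matrix ((*) (c::complex)) (M + N) = map_matrix ((*) c) M + map_matrix ((*) c) N"
  by (simp add: vec_eq_iff distrib_left)

lemma map_matrix_add_left:
  "map_matrix ((*) (c + d::complex)) M = map_matrix ((*) c) M + map_matrix ((*) d) M"
  by (simp add: vec_eq_iff distrib_right)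

lemma map_matrix_map_matrix:
  "map_matrix ((*) (c::complex)) (map_matrix ((*) d) M) = map_matrix ((*) (c * d)) M"
  by (simp add: vec_eq_iff)

lemma map_matrix_diff:
  "map_matrix ((*) (c::complex)) (M - N) = map_matrix ((*) c) M - map_matrix ((*) c) N"
  by (simp add: vec_eq_iff right_diff_distrib)

lemma matrix_mul_add_right:
  fixes A :: "complex ^ 'n::finite ^ 'm"
  shows "(A + B) ** C = A ** C + B ** C"
  by (simp add: vec_eq_iff matrix_matrix_mult_def distrib_right sum.distrib)

lemma matrix_mul_diff_left:
  fixes A :: "complex ^ 'n::finite ^ 'm"
  shows "A ** (B - C) = A ** B - A ** C"
  by (simp add: vec_eq_iff matrix_matrix_mult_def right_diff_distrib sum_subtractf)

lemma matrix_mul_diff_right: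
  fixes A :: "complex ^ 'n::finite ^ 'm"
  shows "(A - B) ** C = A ** C - B ** C"
  by (simp add: vec_eq_iff matrix_matrix_mult_def left_diff_distrib sum_subtractf)

lemma matrix_mul_minus_left:
  fixes A :: "complex ^ 'n::finite ^ 'm"
  shows "(- A) ** C = - (A ** C)"
  by (simp add: vec_eq_iff matrix_matrix_mult_def sum_negf)

lemma matrix_mul_minus_right:
  fixes A :: "complex ^ 'n::finite ^ 'm"
  shows "A ** (- C) = - (A ** C)"
  by (simp add: vec_eq_iff matrix_matrix_mult_def sum_negf)

lemma matrix_mul_map_left:
  fixes A :: "complex ^ 'n::finite ^ 'm"
  shows "map_matrix ((*) c) A ** B = map_matrix ((*) c) (A ** B)"
  by (simp add: vec_eq_iff matrix_matrix_mult_def sum_distrib_left mult_ac)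

lemma matrix_mul_map_right:
  fixes A :: "complex ^ 'n::finite ^ 'm"
  shows "A ** map_matrix ((*) c) B = map_matrix ((*) c) (A ** B)"
  by (simp add: vec_eq_iff matrix_matrix_mult_def sum_distrib_left mult_ac)

lemma map_matrix_mult_vec:
  fixes A :: "complex ^ 'n::finite ^ 'm"
  shows "map_matrix ((*) c) A *v v = c *s (A *v v)"
  by (simp add: vec_eq_iff matrix_vector_mult_def sum_distrib_left mult_ac)

lemma mat_component_add: "mat_component a (M + N) = mat_component a M + mat_component a N"
  by (simp add: mat_component_def vec_eq_iff)

lemma mat_component_map:
  "mat_component a (map_matrix ((*) c) M) = map_matrix ((*) c) (mat_component a M)"
  by (simp add: mat_component_def vec_eq_iff)

lemma mat_component_gl_part:
  assumes "M \<in> gl_part b"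
  shows "mat_component a M = (if a = b then M else 0)"
proof -
  have "M $ i $ j = 0" if "index_parity i + index_parity j \<noteq> b" for i j
    using assms that unfolding gl_part_def by blast
  then show ?thesis
    by (cases a; cases b) (simp_all add: mat_component_def vec_eq_iff)
qed

lemma supercommutator_add_left:
  "supercommutator (M + M') N = supercommutator M N + supercommutator M' N"
  by (simp add: supercommutator_def mat_component_add matrix_add_ldistrib matrix_mul_add_right
      map_matrix_add algebra_simps)

lemma supercommutator_add_right:
  "supercommutator M (N + N') = supercommutator M N + supercommutator M N'"
  by (simp add: supercommutator_def mat_component_add matrix_add_ldistrib matrix_mul_add_right
      map_matrix_add algebra_simps)

lemma supercommutator_map_left:
  "supercommutator (map_matrix ((*) c) M) N = map_matrix ((*) c) (supercommutator M N)"
  by (simp add: supercommutator_def mat_component_map matrix_mul_map_left matrix_mul_map_right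
      map_matrix_map_matrix map_matrix_add map_matrix_diff mult.commute)

lemma supercommutator_map_right:
  "supercommutator M (map_matrix ((*) c) N) = map_matrix ((*) c) (supercommutator M N)"
  by (simp add: supercommutator_def mat_component_map matrix_mul_map_left matrix_mul_map_right
      map_matrix_map_matrix map_matrix_add map_matrix_diff mult.commute)

lemma matrix_mul_zero [simp]:
  fixes A :: "complex ^ 'n::finite ^ 'm"
  shows "A ** 0 = 0" "0 ** B = (0 :: complex ^ 'n ^ 'm)"
  by (simp_all add: vec_eq_iff matrix_matrix_mult_def)

text \<open>Of the four pairs of components in the bilinear extension only the pair of parities
  \<open>a\<close>, \<open>b\<close> survives. This form reduces skew-symmetry, the Jacobi identity
  and the explicit brackets to matrix products.\<close>

lemma supercommutator_gl_part:
  assumes "M \<in> gl_part a" "N \<in> gl_part b"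
  shows "supercommutator M N = M ** N - map_matrix ((*) (koszul a b)) (N ** M)"
  by (cases a; cases b)
    (simp_all add: supercommutator_def mat_component_gl_part[OF assms(1)]
      mat_component_gl_part[OF assms(2)])

lemma gl_part_mult:
  assumes "M \<in> gl_part a" "N \<in> gl_part b"
  shows "M ** N \<in> gl_part (a + b)"
proof -
  have "index_parity i + index_parity j = a + b" if "(M ** N) $ i $ j \<noteq> 0" for i j
  proof -
    from that have "(\<Sum>k\<in>UNIV. M $ i $ k * N $ k $ j) \<noteq> 0"
      by (simp add: matrix_matrix_mult_def)
    then obtain k where "M $ i $ k * N $ k $ j \<noteq> 0"
      by (meson sum.neutral)
    then have "M $ i $ k \<noteq> 0" "N $ k $ j \<noteq> 0"
      by auto
    then have "a = index_parity i + index_parity k" "b = index_parity k + index_parity j"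
      using assms unfolding gl_part_def by blast+
    then show ?thesis
      \<comment> \<open>The parity of the intermediate index \<open>k\<close> occurs twice in
        \<open>a + b\<close> and cancels in characteristic 2.\<close>
      by (cases "index_parity i"; cases "index_parity j"; cases "index_parity k") simp_all
  qed
  then show ?thesis
    by (simp add: gl_part_def)
qed

lemma gl_part_diff: "M \<in> gl_part a \<Longrightarrow> N \<in> gl_part a \<Longrightarrow> M - N \<in> gl_part a"
  unfolding gl_part_def by (smt (verit) mem_Collect_eq diff_self vector_minus_component)

lemma gl_part_add: "M \<in> gl_part a \<Longrightarrow> N \<in> gl_part a \<Longrightarrow> M + N \<in> gl_part a"
  unfolding gl_part_def by (smt (verit) mem_Collect_eq add_0 vector_add_component)

lemma gl_part_map: "M \<in> gl_part a \<Longrightarrow> map_matrix ((*) c) M \<in> gl_part a"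
  by (auto simp: gl_part_def)

lemma gl_part_supercommutator:
  assumes "M \<in> gl_part a" "N \<in> gl_part b"
  shows "supercommutator M N \<in> gl_part (a + b)"
  unfolding supercommutator_gl_part[OF assms]
  using gl_part_mult[OF assms(2,1)]
  by (intro gl_part_diff gl_part_map gl_part_mult[OF assms]) (simp only: add.commute)

lemma gl_part_Int:
  assumes "M \<in> gl_part 0" "M \<in> gl_part 1"
  shows "M = 0"
proof -
  have "M $ i $ j = 0" for i j
    using assms by (force simp: gl_part_def)
  then show ?thesis
    by (simp add: vec_eq_iff)
qed

lemma supercommutator_skew:
  assumes "M \<in> gl_part a" "N \<in> gl_part b"
  shows "supercommutator M N = - map_matrix ((*) (koszul a b)) (supercommutator N M)"
  unfolding supercommutator_gl_part[OF assms] supercommutator_gl_part[OF assms(2,1)]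
  by (cases a; cases b) simp_all

text \<open>Inner brackets are homogeneous, so every bracket expands into associative products. Once
  the three parities are fixed the signs are explicit, and the products cancel by
  associativity.\<close>

lemma supercommutator_jacobi:
  assumes "M \<in> gl_part a" "N \<in> gl_part b" "K \<in> gl_part d"
  shows "supercommutator M (supercommutator N K) =
    supercommutator (supercommutator M N) K
      + map_matrix ((*) (koszul a b)) (supercommutator N (supercommutator M K))"
  \<comment> \<open>The outer brackets are expanded first, because the equations for them mention
    the inner brackets in unexpanded form.\<close>
  unfolding
    supercommutator_gl_part[OF assms(1) gl_part_supercommutator[OF assms(2,3)]]
    supercommutator_gl_part[OF gl_part_supercommutator[OF assms(1,2)] assms(3)]
    supercommutator_gl_part[OF assms(2) gl_part_supercommutator[OF assms(1,3)]]
  unfolding supercommutator_gl_part[OF assms(1,2)] supercommutator_gl_part[OF assms(1,3)]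
    supercommutator_gl_part[OF assms(2,3)]
  by (cases a; cases b; cases d)
    (simp_all add: matrix_mul_diff_left matrix_mul_diff_right matrix_mul_minus_left
      matrix_mul_minus_right matrix_add_ldistrib matrix_mul_add_right matrix_mul_assoc)

section \<open>The Lie superalgebra osp(1|2)\<close>

lemma vec_part_mult:
  assumes "M \<in> gl_part a" "v \<in> vec_part b"
  shows "M *v v \<in> vec_part (a + b)"
proof -
  have "index_parity i = a + b" if "(M *v v) $ i \<noteq> 0" for i
  proof -
    from that have "(\<Sum>k\<in>UNIV. M $ i $ k * v $ k) \<noteq> 0"
      by (simp add: matrix_vector_mult_def)
    then obtain k where "M $ i $ k * v $ k \<noteq> 0"
      by (meson sum.neutral)
    then have "M $ i $ k \<noteq> 0" "v $ k \<noteq> 0"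
      by auto
    then have "a = index_parity i + index_parity k" "b = index_parity k"
      using assms unfolding gl_part_def vec_part_def by blast+
    then show ?thesis
      by (cases "index_parity i"; cases "index_parity k") simp_all
  qed
  then show ?thesis
    by (simp add: vec_part_def)
qed

lemma osp12_form_simps [simp]:
  "osp12_form (v + v') w = osp12_form v w + osp12_form v' w"
  "osp12_form v (w + w') = osp12_form v w + osp12_form v w'"
  "osp12_form (v - v') w = osp12_form v w - osp12_form v' w"
  "osp12_form v (w - w') = osp12_form v w - osp12_form v w'"
  "osp12_form (c *s v) w = c * osp12_form v w"
  "osp12_form v (c *s w) = c * osp12_form v w"
  by (simp_all add: osp12_form_def algebra_simps)

lemma osp12_partD:
  assumes "M \<in> osp12_part a" "v \<in> vec_part b"
  shows "osp12_form (M *v v) w = - koszul a b * osp12_form v (M *v w)"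
  using assms by (auto simp: osp12_part_def eq_neg_iff_add_eq_0)

lemma osp12_part_gl: "M \<in> osp12_part a \<Longrightarrow> M \<in> gl_part a"
  by (simp add: osp12_part_def)

text \<open>Moving the two factors of \<open>M ** N\<close> across the form one after the other
  reverses their order, and the two minus signs cancel. The remaining Koszul signs turn the
  supercommutator on the left into minus the supercommutator on the right.\<close>

lemma osp12_part_supercommutator:
  assumes "M \<in> osp12_part a" "N \<in> osp12_part b"
  shows "supercommutator M N \<in> osp12_part (a + b)"
proof -
  note gl = osp12_part_gl[OF assms(1)] osp12_part_gl[OF assms(2)]
  have "osp12_form (supercommutator M N *v v) w
      + koszul (a + b) d * osp12_form v (supercommutator M N *v w) = 0"
    if v: "v \<in> vec_part d" for d v w
  proof -
    \<comment> \<open>The first sign is \<open>koszul a (b + d)\<close>, since \<open>M\<close> acts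
      on \<open>N *v v\<close>, which has parity \<open>b + d\<close>.\<close>
    have "osp12_form (M *v (N *v v)) w =
        koszul a (b + d) * (koszul b d * osp12_form v (N *v (M *v w)))"
      using osp12_partD[OF assms(1) vec_part_mult[OF gl(2) v]] osp12_partD[OF assms(2) v] by simp
    moreover have "osp12_form (N *v (M *v v)) w =
        koszul b (a + d) * (koszul a d * osp12_form v (M *v (N *v w)))"
      using osp12_partD[OF assms(2) vec_part_mult[OF gl(1) v]] osp12_partD[OF assms(1) v] by simp
    ultimately show ?thesis
      unfolding supercommutator_gl_part[OF gl] matrix_vector_mult_diff_rdistrib
        map_matrix_mult_vec matrix_vector_mul_assoc[symmetric]
      by (cases a; cases b; cases d) simp_all
  qed
  then show ?thesis
    using gl_part_supercommutator[OF gl] by (simp add: osp12_part_def)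
qed

lemma osp12_simps [simp]:
  "scl osp12 c = map_matrix ((*) c)" "part osp12 = osp12_part" "brk osp12 = supercommutator"
  by (simp_all add: osp12_def)

lemma lie_superalgebra_osp12: "lie_superalgebra osp12"
proof (rule lie_superalgebra.intro)
  show vs: "vector_space (scl osp12)"
    by unfold_locales
      (simp_all add: map_matrix_add map_matrix_add_left map_matrix_map_matrix)
  then interpret vector_space "scl osp12" .
  have zero: "0 \<in> osp12_part a" for a
    by (simp add: osp12_part_def gl_part_def osp12_form_def)
  have add: "M + N \<in> osp12_part a" if "M \<in> osp12_part a" "N \<in> osp12_part a" for M N a
  proof -
    have "osp12_form ((M + N) *v v) w + koszul a b * osp12_form v ((M + N) *v w) = 0"
      if "v \<in> vec_part b" for b v w
      using osp12_partD[OF \<open>M \<in> osp12_part a\<close> that] osp12_partD[OF \<open>N \<in> osp12_part a\<close> that]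
      by (simp add: matrix_vector_mult_add_rdistrib algebra_simps)
    then show ?thesis
      using that by (simp add: osp12_part_def gl_part_add)
  qed
  have scale: "map_matrix ((*) c) M \<in> osp12_part a" if "M \<in> osp12_part a" for M c a
  proof -
    have "osp12_form (map_matrix ((*) c) M *v v) w
        + koszul a b * osp12_form v (map_matrix ((*) c) M *v w) = 0"
      if "v \<in> vec_part b" for b v w
      using osp12_partD[OF \<open>M \<in> osp12_part a\<close> that] by (simp add: map_matrix_mult_vec)
    then show ?thesis
      using that by (simp add: osp12_part_def gl_part_map)
  qed
  show "module.subspace (scl osp12) (part osp12 a)" for a
    using zero add scale by (auto simp: subspace_def)
  show "part osp12 0 \<inter> part osp12 1 = {0}"
    using gl_part_Int by (auto simp: zero dest: osp12_part_gl)
  show "brk osp12 M N \<in> part osp12 (a + b)"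
    if "M \<in> part osp12 a" "N \<in> part osp12 b" for M N a b
    using osp12_part_supercommutator that unfolding osp12_simps .
\<comment> \<open>The remaining axioms are inherited from the bracket on all block matrices.\<close>
qed (unfold osp12_simps, (rule supercommutator_add_left supercommutator_add_right
    supercommutator_map_left supercommutator_map_right supercommutator_skew
    supercommutator_jacobi; erule osp12_part_gl)+)

section \<open>Explicit matrices and brackets of osp(1|2)\<close>

lemma UNIV_2_eq: "(UNIV :: 2 set) = {0, 1}"
proof -
  \<comment> \<open>\<open>UNIV_2\<close> names the two elements 1 and 2, whereas the odd
    coordinates are indexed by 0 and 1.\<close>
  have "(2 :: 2) = 0"
    by simp
  then show ?thesis
    by (simp only: UNIV_2 insert_commute)
qed

lemma UNIV_index12: "(UNIV :: (1 + 2) set) = {Inl 0, Inr 0, Inr 1}"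
  unfolding UNIV_Plus_UNIV[symmetric] UNIV_2_eq by (auto intro: num1_eqI)

lemma sum_index12: "(\<Sum>i\<in>UNIV. f (i :: 1 + 2)) = f (Inl 0) + f (Inr 0) + f (Inr 1)"
  by (simp add: UNIV_index12 add.assoc)

lemma forall_index12: "(\<forall>i :: 1 + 2. Q i) \<longleftrightarrow> Q (Inl 0) \<and> Q (Inr 0) \<and> Q (Inr 1)"
  using UNIV_index12 by (metis UNIV_I insertE singletonD)

text \<open>The even basis vector is sent to the odd vector with coordinates \<open>a\<close>,
  \<open>b\<close>; invariance of the form then forces the row at \<open>Inl 0\<close>.\<close>

definition osp12_odd :: "complex \<Rightarrow> complex \<Rightarrow> complex ^ (1 + 2) ^ (1 + 2)" where
  "osp12_odd a b = (\<chi> i j. case (i, j) of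
      (Inl _, Inr k) \<Rightarrow> if k = 0 then b else - a
    | (Inr k, Inl _) \<Rightarrow> if k = 0 then a else b
    | _ \<Rightarrow> 0)"

text \<open>The even part is sp(2) = sl(2), a traceless block acting on the odd coordinates.\<close>

definition osp12_even :: "complex \<Rightarrow> complex \<Rightarrow> complex \<Rightarrow> complex ^ (1 + 2) ^ (1 + 2)" where
  "osp12_even a b c = (\<chi> i j. case (i, j) of
      (Inr k, Inr l) \<Rightarrow>
        if k = 0 then (if l = 0 then a else b) else (if l = 0 then c else - a)
    | _ \<Rightarrow> 0)"

lemma osp12_odd_eq_iff: "osp12_odd a b = osp12_odd a' b' \<longleftrightarrow> a = a' \<and> b = b'"
  by (auto simp: vec_eq_iff forall_index12 osp12_odd_def)

lemma osp12_even_eq_iff: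
  "osp12_even a b c = osp12_even a' b' c' \<longleftrightarrow> a = a' \<and> b = b' \<and> c = c'"
  by (auto simp: vec_eq_iff forall_index12 osp12_even_def)

lemma osp12_part_1: "osp12_part 1 = {osp12_odd a b | a b. True}"
proof (intro subset_antisym subsetI)
  fix M :: "complex ^ (1 + 2) ^ (1 + 2)"
  assume M: "M \<in> osp12_part 1"
  \<comment> \<open>Pairing the even basis vector with the two odd ones expresses the row at
    \<open>Inl 0\<close> by the column at \<open>Inl 0\<close>; all other entries vanish by
    parity.\<close>
  have e: "axis (Inl 0) 1 \<in> vec_part 0"
    by (simp add: vec_part_def forall_index12 axis_def)
  have "M $ Inr 1 $ Inl 0 = M $ Inl 0 $ Inr 0" "M $ Inr 0 $ Inl 0 = - M $ Inl 0 $ Inr 1"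
    using osp12_partD[OF M e, of "axis (Inr 0) 1"] osp12_partD[OF M e, of "axis (Inr 1) 1"]
    by (simp_all add: osp12_form_def matrix_vector_mult_def sum_index12 axis_def)
  then have "M = osp12_odd (M $ Inr 0 $ Inl 0) (M $ Inr 1 $ Inl 0)"
    using osp12_part_gl[OF M]
    by (simp add: vec_eq_iff forall_index12 osp12_odd_def gl_part_def)
  then show "M \<in> {osp12_odd a b | a b. True}"
    by blast
next
  fix M
  assume "M \<in> {osp12_odd a b | a b. True}"
  then obtain a b where M: "M = osp12_odd a b"
    by blast
  show "M \<in> osp12_part 1"
    unfolding osp12_part_def mem_Collect_eq
  proof (intro conjI allI ballI)
    show "M \<in> gl_part 1"
      by (simp add: M gl_part_def forall_index12 osp12_odd_def)
    show "osp12_form (M *v v) w + koszul 1 d * osp12_form v (M *v w) = 0"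
      if "v \<in> vec_part d" for d v w
      using that
      by (cases d)
        (simp_all add: M osp12_odd_def osp12_form_def vec_part_def matrix_vector_mult_def
          sum_index12 forall_index12 algebra_simps)
  qed
qed

lemma osp12_part_0: "osp12_part 0 = {osp12_even a b c | a b c. True}"
proof (intro subset_antisym subsetI)
  fix M :: "complex ^ (1 + 2) ^ (1 + 2)"
  assume M: "M \<in> osp12_part 0"
  \<comment> \<open>The even vector paired with itself kills the entry at \<open>Inl 0\<close>, as
    the form is symmetric there. The two odd vectors paired with each other give trace zero on the
    odd block.\<close>
  have e: "axis (Inl 0) 1 \<in> vec_part 0" "axis (Inr 0) 1 \<in> vec_part 1"
    by (simp_all add: vec_part_def forall_index12 axis_def)
  have "M $ Inl 0 $ Inl 0 = 0" "M $ Inr 1 $ Inr 1 = - M $ Inr 0 $ Inr 0"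
    using osp12_partD[OF M e(1), of "axis (Inl 0) 1"] osp12_partD[OF M e(2), of "axis (Inr 1) 1"]
    by (simp_all add: osp12_form_def matrix_vector_mult_def sum_index12 axis_def)
  then have "M = osp12_even (M $ Inr 0 $ Inr 0) (M $ Inr 0 $ Inr 1) (M $ Inr 1 $ Inr 0)"
    using osp12_part_gl[OF M]
    by (simp add: vec_eq_iff forall_index12 osp12_even_def gl_part_def)
  then show "M \<in> {osp12_even a b c | a b c. True}"
    by blast
next
  fix M
  assume "M \<in> {osp12_even a b c | a b c. True}"
  then obtain a b c where M: "M = osp12_even a b c"
    by blast
  show "M \<in> osp12_part 0"
    unfolding osp12_part_def mem_Collect_eq
  proof (intro conjI allI ballI)
    show "M \<in> gl_part 0"
      by (simp add: M gl_part_def forall_index12 osp12_even_def)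
    show "osp12_form (M *v v) w + koszul 0 d * osp12_form v (M *v w) = 0" for d v w
      by (simp add: M osp12_even_def osp12_form_def matrix_vector_mult_def sum_index12
          algebra_simps)
  qed
qed

lemma osp12_odd_in_part: "osp12_odd a b \<in> osp12_part 1"
  by (auto simp: osp12_part_1)

lemma osp12_even_in_part: "osp12_even a b c \<in> osp12_part 0"
  by (auto simp: osp12_part_0)

lemma supercommutator_odd_odd:
  "supercommutator (osp12_odd a b) (osp12_odd c d) =
    osp12_even (a * d + b * c) (- 2 * a * c) (2 * b * d)"
  unfolding supercommutator_gl_part[OF osp12_part_gl osp12_part_gl,
      OF osp12_odd_in_part osp12_odd_in_part]
  by (simp add: vec_eq_iff forall_index12 matrix_matrix_mult_def sum_index12 osp12_odd_def
      osp12_even_def algebra_simps)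

lemma supercommutator_even_odd:
  "supercommutator (osp12_even a b c) (osp12_odd u v) =
    osp12_odd (a * u + b * v) (c * u - a * v)"
  unfolding supercommutator_gl_part[OF osp12_part_gl osp12_part_gl,
      OF osp12_even_in_part osp12_odd_in_part]
  by (simp add: vec_eq_iff forall_index12 matrix_matrix_mult_def sum_index12 osp12_odd_def
      osp12_even_def algebra_simps)

lemma osp12_odd_linear:
  "osp12_odd a b + osp12_odd a' b' = osp12_odd (a + a') (b + b')"
  "map_matrix ((*) c) (osp12_odd a b) = osp12_odd (c * a) (c * b)"
  by (simp_all add: vec_eq_iff forall_index12 osp12_odd_def)

lemma osp12_even_linear:
  "osp12_even a b c + osp12_even a' b' c' = osp12_even (a + a') (b + b') (c + c')"
  "map_matrix ((*) k) (osp12_even a b c) = osp12_even (k * a) (k * b) (k * c)"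
  by (simp_all add: vec_eq_iff forall_index12 osp12_even_def)

section \<open>Evaluation of expressions\<close>

primrec lterm_eval :: "'a::ab_group_add superalgebra \<Rightarrow> ('g \<Rightarrow> 'a) \<Rightarrow> 'g lterm \<Rightarrow> 'a" where
  "lterm_eval A f (Gen g) = f g"
| "lterm_eval A f Zero = 0"
| "lterm_eval A f (Add s t) = lterm_eval A f s + lterm_eval A f t"
| "lterm_eval A f (Scale c t) = scl A c (lterm_eval A f t)"
| "lterm_eval A f (Br s t) = brk A (lterm_eval A f s) (lterm_eval A f t)"

section \<open>Evaluation in a Lie superalgebra respects the generated congruence\<close>

context lie_superalgebra
begin

interpretation vs: vector_space "scl A"
  by (rule vector_space_scl)

lemma part_zero: "0 \<in> part A a"
  using vs.subspace_0[OF subspace_part] .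

lemma part_add: "x \<in> part A a \<Longrightarrow> y \<in> part A a \<Longrightarrow> x + y \<in> part A a"
  using vs.subspace_add[OF subspace_part] .

lemma part_scl: "x \<in> part A a \<Longrightarrow> scl A c x \<in> part A a"
  using vs.subspace_scale[OF subspace_part] .

lemma part_car: "x \<in> part A a \<Longrightarrow> x \<in> car A"
  using part_zero unfolding car_def by (cases a) force+

lemma car_add:
  assumes "x \<in> car A" "y \<in> car A"
  shows "x + y \<in> car A"
proof -
  obtain a b c d where "x = a + b" "y = c + d" "a \<in> part A 0" "b \<in> part A 1"
      "c \<in> part A 0" "d \<in> part A 1"
    using assms by (auto simp: car_def)
  then have "x + y = (a + c) + (b + d)" "a + c \<in> part A 0" "b + d \<in> part A 1"
    by (simp_all add: part_add algebra_simps)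
  then show ?thesis
    unfolding car_def by blast
qed

lemma car_scl: "x \<in> car A \<Longrightarrow> scl A c x \<in> car A"
  unfolding car_def using part_scl by (fastforce simp: vs.scale_right_distrib)

lemma car_brk:
  assumes "x \<in> car A" "y \<in> car A"
  shows "brk A x y \<in> car A"
proof -
  obtain a b c d where eq: "x = a + b" "y = c + d" and mem: "a \<in> part A 0" "b \<in> part A 1"
      "c \<in> part A 0" "d \<in> part A 1"
    using assms by (auto simp: car_def)
  have "brk A x y = (brk A a c + brk A a d) + (brk A b c + brk A b d)"
    using mem[THEN part_car] by (simp add: eq brk_add_left brk_add_right car_add)
  then show ?thesis
    using mem by (auto intro!: car_add intro: part_car[OF brk_part])
qed

context
  fixes gpar :: "'g \<Rightarrow> bit" and f :: "'g \<Rightarrow> 'a"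
  assumes gens: "\<And>g. f g \<in> part A (gpar g)"
begin

lemma lterm_eval_part: "homog gpar a t \<Longrightarrow> lterm_eval A f t \<in> part A a"
  by (induction rule: homog.induct)
    (simp_all only: lterm_eval.simps gens part_zero part_add part_scl brk_part)

text \<open>Bilinearity of the bracket is available only on \<open>car A\<close>, so every value has
  to be located there, including values of inhomogeneous expressions.\<close>

lemma lterm_eval_car: "lterm_eval A f t \<in> car A"
  by (induction t)
    (auto intro: part_car[OF gens] part_car[OF part_zero] car_add car_scl car_brk)

text \<open>This is the universal property of the presentation: each rule of \<open>lie_eq\<close>
  is an axiom of \<open>A\<close>, except for the relations, which are assumed to hold for the
  chosen images of the generators.\<close>

lemma lterm_eval_lie_eq:
  assumes "\<And>s t. (s, t) \<in> R \<Longrightarrow> lterm_eval A f s = lterm_eval A f t"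
  shows "lie_eq gpar R s t \<Longrightarrow> lterm_eval A f s = lterm_eval A f t"
proof (induction rule: lie_eq.induct)
  case (skew a s b t)
  then show ?case
    \<comment> \<open>The congruence keeps the minus sign inside the scalar, the axiom
      outside.\<close>
    unfolding lterm_eval.simps vs.scale_minus_left by (intro brk_skew lterm_eval_part)
next
  case (jacobi a s b t d u)
  then show ?case
    unfolding lterm_eval.simps by (intro brk_jacobi lterm_eval_part)
next
  case (relation s t)
  then show ?case
    by (rule assms)
qed (simp_all add: lterm_eval_car brk_add_left brk_add_right brk_scl_left brk_scl_right
    add_ac vs.scale_left_distrib vs.scale_right_distrib)

end

end

section \<open>The Lie superalgebra with generators x and p\<close>

interpretation xp: vector_space xp_scale
  by unfold_locales
    (transfer, meson lie_eq.intros)+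

lemma xp_bracket_add_left: "xp_bracket (u + v) w = xp_bracket u w + xp_bracket v w"
  by transfer (rule lie_eq.br_add_left)

lemma xp_bracket_add_right: "xp_bracket u (v + w) = xp_bracket u v + xp_bracket u w"
  by transfer (rule lie_eq.br_add_right)

lemma xp_bracket_scale_left: "xp_bracket (xp_scale c u) v = xp_scale c (xp_bracket u v)"
  by transfer (rule lie_eq.br_scale_left)

lemma xp_bracket_scale_right: "xp_bracket u (xp_scale c v) = xp_scale c (xp_bracket u v)"
  by transfer (rule lie_eq.br_scale_right)

lemma xp_simps [simp]:
  "scl xp_superalgebra = xp_scale" "brk xp_superalgebra = xp_bracket"
  by (simp_all add: xp_superalgebra_def)

abbreviation xp_part :: "bit \<Rightarrow> xp_carrier set" where
  "xp_part \<equiv> part xp_superalgebra"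

lemma xp_part_def: "xp_part a = abs_xp_carrier ` {t. homog xp_parity a t}"
  by (simp add: xp_superalgebra_def)

lemma xp_part_zero: "0 \<in> xp_part a"
  by (auto simp: xp_part_def zero_xp_carrier.abs_eq intro: homog_Zero)

lemma xp_part_add: "u \<in> xp_part a \<Longrightarrow> v \<in> xp_part a \<Longrightarrow> u + v \<in> xp_part a"
  by (auto simp: xp_part_def plus_xp_carrier.abs_eq intro: homog_Add)

lemma xp_part_scale: "u \<in> xp_part a \<Longrightarrow> xp_scale c u \<in> xp_part a"
  by (auto simp: xp_part_def xp_scale.abs_eq intro: homog_Scale)

lemma xp_part_bracket: "u \<in> xp_part a \<Longrightarrow> v \<in> xp_part b \<Longrightarrow> xp_bracket u v \<in> xp_part (a + b)"
  unfolding xp_part_def by (force simp only: xp_bracket.abs_eq intro: homog_Br)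

text \<open>An element of \<open>xp_part a\<close> has a homogeneous representative, to which the
  rule of the congruence applies.\<close>

lemma xp_bracket_skew:
  assumes "u \<in> xp_part a" "v \<in> xp_part b"
  shows "xp_bracket u v = - xp_scale (koszul a b) (xp_bracket v u)"
proof -
  obtain s t where st: "u = abs_xp_carrier s" "v = abs_xp_carrier t"
      "homog xp_parity a s" "homog xp_parity b t"
    using assms by (auto simp: xp_part_def)
  have "xp_bracket u v = xp_scale (- koszul a b) (xp_bracket v u)"
    unfolding st(1,2) xp_bracket.abs_eq xp_scale.abs_eq xp_carrier.abs_eq_iff
    using st(3,4) by (rule lie_eq.skew)
  then show ?thesis
    by simp
qed

lemma xp_bracket_jacobi:
  assumes "u \<in> xp_part a" "v \<in> xp_part b" "w \<in> xp_part d"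
  shows "xp_bracket u (xp_bracket v w) =
    xp_bracket (xp_bracket u v) w + xp_scale (koszul a b) (xp_bracket v (xp_bracket u w))"
proof -
  obtain r s t where rst: "u = abs_xp_carrier r" "v = abs_xp_carrier s" "w = abs_xp_carrier t"
      "homog xp_parity a r" "homog xp_parity b s" "homog xp_parity d t"
    using assms by (auto simp: xp_part_def)
  show ?thesis
    unfolding rst(1-3) xp_bracket.abs_eq xp_scale.abs_eq plus_xp_carrier.abs_eq
      xp_carrier.abs_eq_iff
    using rst(4-6) by (rule lie_eq.jacobi)
qed

lift_definition xp_x :: xp_carrier is "Gen X" .

lift_definition xp_p :: xp_carrier is "Gen P" .

lemma xp_x_part: "xp_x \<in> xp_part 1"
  using homog_Gen[of xp_parity X] by (simp add: xp_x.abs_eq xp_part_def xp_parity_def)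

lemma xp_p_part: "xp_p \<in> xp_part 1"
  using homog_Gen[of xp_parity P] by (simp add: xp_p.abs_eq xp_part_def xp_parity_def)

lemma xp_relation_x: "xp_bracket (xp_bracket xp_x xp_p) xp_x = xp_scale (- 2 * \<i>) xp_x"
  by transfer (auto simp: xp_relations_def intro!: lie_eq.relation)

lemma xp_relation_p: "xp_bracket (xp_bracket xp_x xp_p) xp_p = xp_scale (2 * \<i>) xp_p"
  by transfer (auto simp: xp_relations_def intro!: lie_eq.relation)

section \<open>The five spanning elements and their brackets with the generators\<close>

definition xp_odd :: "complex \<Rightarrow> complex \<Rightarrow> xp_carrier" where
  "xp_odd a b = xp_scale a xp_x + xp_scale b xp_p"

definition xp_even :: "complex \<Rightarrow> complex \<Rightarrow> complex \<Rightarrow> xp_carrier" where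
  "xp_even a b c =
    xp_scale a (xp_bracket xp_x xp_x) + xp_scale b (xp_bracket xp_x xp_p)
      + xp_scale c (xp_bracket xp_p xp_p)"

lemma xp_bracket_even:
  assumes "u \<in> xp_part 1" "v \<in> xp_part 1"
  shows "xp_bracket u v \<in> xp_part 0"
  using xp_part_bracket[OF assms] by simp

lemma xp_odd_part: "xp_odd a b \<in> xp_part 1"
  by (simp add: xp_odd_def xp_part_add xp_part_scale xp_x_part xp_p_part)

lemma xp_even_part: "xp_even a b c \<in> xp_part 0"
  by (simp add: xp_even_def xp_part_add xp_part_scale xp_bracket_even xp_x_part xp_p_part)

lemma xp_bracket_p_x: "xp_bracket xp_p xp_x = xp_bracket xp_x xp_p"
  using xp_bracket_skew[OF xp_p_part xp_x_part] by simp

text \<open>With \<open>c = [u,[u,u]]\<close>, skew-symmetry turns the Jacobi identity into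
  \<open>c = - c - c\<close>; hence \<open>3c = 0\<close>, and 3 is invertible.\<close>

lemma xp_bracket_square_self:
  assumes u: "u \<in> xp_part 1"
  shows "xp_bracket u (xp_bracket u u) = 0"
proof -
  let ?c = "xp_bracket u (xp_bracket u u)"
  have "xp_bracket (xp_bracket u u) u = - ?c"
    using xp_bracket_skew[OF xp_bracket_even[OF u u] u] by simp
  then have "?c = - ?c - ?c"
    using xp_bracket_jacobi[OF u u u] by simp
  then have "?c + ?c + ?c = 0"
    by (metis add.right_inverse diff_add_cancel add.commute)
  moreover have "xp_scale 3 ?c = ?c + ?c + ?c"
    using xp.scale_left_distrib[of 2 1 ?c] xp.scale_left_distrib[of 1 1 ?c] by simp
  ultimately show ?thesis
    by simp
qed

text \<open>The Jacobi identity yields \<open>[[u,v],v] - [v,[u,v]]\<close>, whose two terms agree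
  by skew-symmetry. For distinct generators this brings the bracket with a square back to a defining
  relation.\<close>

lemma xp_bracket_square:
  assumes u: "u \<in> xp_part 1" and v: "v \<in> xp_part 1"
  shows "xp_bracket u (xp_bracket v v) = xp_scale 2 (xp_bracket (xp_bracket u v) v)"
proof -
  have "xp_bracket v (xp_bracket u v) = - xp_bracket (xp_bracket u v) v"
    using xp_bracket_skew[OF v xp_bracket_even[OF u v]] by simp
  then show ?thesis
    using xp_bracket_jacobi[OF u v v]
      xp.scale_left_distrib[of 1 1 "xp_bracket (xp_bracket u v) v"] by simp
qed

lemma xp_bracket_x_odd: "xp_bracket xp_x (xp_odd a b) = xp_even a b 0"
  by (simp add: xp_odd_def xp_even_def xp_bracket_add_right xp_bracket_scale_right)

lemma xp_bracket_p_odd: "xp_bracket xp_p (xp_odd a b) = xp_even 0 a b"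
  by (simp add: xp_odd_def xp_even_def xp_bracket_add_right xp_bracket_scale_right xp_bracket_p_x)

text \<open>The contributions are \<open>[x,[x,x]] = 0\<close>, \<open>[x,[x,p]] = 2\<i>x\<close> by
  the first relation, and \<open>[x,[p,p]] = 2[[x,p],p] = 4\<i>p\<close> by the second.\<close>

lemma xp_bracket_x_even: "xp_bracket xp_x (xp_even a b c) = xp_odd (2 * \<i> * b) (4 * \<i> * c)"
proof -
  have "xp_bracket xp_x (xp_bracket xp_x xp_p) = xp_scale (2 * \<i>) xp_x"
    using xp_bracket_skew[OF xp_x_part xp_bracket_even[OF xp_x_part xp_p_part]]
    by (simp add: xp_relation_x)
  then show ?thesis
    by (simp add: xp_odd_def xp_even_def xp_bracket_add_right xp_bracket_scale_right
        xp_bracket_square_self xp_bracket_square xp_x_part xp_p_part xp_relation_p mult_ac)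
qed

lemma xp_bracket_p_even:
  "xp_bracket xp_p (xp_even a b c) = xp_odd (- 4 * \<i> * a) (- 2 * \<i> * b)"
proof -
  have "xp_bracket xp_p (xp_bracket xp_x xp_p) = xp_scale (- 2 * \<i>) xp_p"
    using xp_bracket_skew[OF xp_p_part xp_bracket_even[OF xp_x_part xp_p_part]]
    by (simp add: xp_relation_p)
  then show ?thesis
    by (simp add: xp_odd_def xp_even_def xp_bracket_add_right xp_bracket_scale_right
        xp_bracket_square_self xp_bracket_square xp_x_part xp_p_part xp_relation_x
        xp_bracket_p_x mult_ac)
qed

text \<open>Explicit coefficients make each element comparable, entry by entry, with its matrix
  image.\<close>

definition xp_span :: "bit \<Rightarrow> xp_carrier set" where
  "xp_span a = (if a = 1 then {xp_odd b c | b c. True} else {xp_even b c d | b c d. True})"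

lemma xp_odd_linear:
  "xp_odd a b + xp_odd a' b' = xp_odd (a + a') (b + b')"
  "xp_scale c (xp_odd a b) = xp_odd (c * a) (c * b)"
  by (simp_all add: xp_odd_def xp.scale_left_distrib xp.scale_right_distrib add_ac)

lemma xp_even_linear:
  "xp_even a b c + xp_even a' b' c' = xp_even (a + a') (b + b') (c + c')"
  "xp_scale k (xp_even a b c) = xp_even (k * a) (k * b) (k * c)"
  by (simp_all add: xp_even_def xp.scale_left_distrib xp.scale_right_distrib add_ac)

lemma xp_span_zero: "0 \<in> xp_span a"
proof -
  have "0 = xp_odd 0 0" "0 = xp_even 0 0 0"
    by (simp_all add: xp_odd_def xp_even_def)
  then show ?thesis
    unfolding xp_span_def by auto
qed

lemma xp_span_add: "u \<in> xp_span a \<Longrightarrow> v \<in> xp_span a \<Longrightarrow> u + v \<in> xp_span a"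
  by (cases a) (fastforce simp: xp_span_def xp_odd_linear xp_even_linear)+

lemma xp_span_scale: "u \<in> xp_span a \<Longrightarrow> xp_scale c u \<in> xp_span a"
  by (cases a) (fastforce simp: xp_span_def xp_odd_linear xp_even_linear)+

lemma xp_span_subset: "xp_span a \<subseteq> xp_part a"
  by (cases a) (auto simp: xp_span_def xp_odd_part xp_even_part)

lemma xp_span_bracket_gen:
  assumes "v \<in> xp_span b"
  shows "xp_bracket xp_x v \<in> xp_span (1 + b)" "xp_bracket xp_p v \<in> xp_span (1 + b)"
  using assms
  by (cases b; auto simp: xp_span_def xp_bracket_x_odd xp_bracket_p_odd xp_bracket_x_even
      xp_bracket_p_even)+

text \<open>
  By the Jacobi identity, the elements whose bracket preserves the span of the five basis vectors
  are closed under brackets; so it suffices to bracket with the two generators.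
\<close>

lemma homog_xp_span:
  "homog xp_parity a t \<Longrightarrow> abs_xp_carrier t \<in> xp_span a \<and>
    (\<forall>b. \<forall>v \<in> xp_span b. xp_bracket (abs_xp_carrier t) v \<in> xp_span (a + b))"
proof (induction rule: homog.induct)
  case (homog_Gen g)
  have "xp_x = xp_odd 1 0" "xp_p = xp_odd 0 1"
    by (simp_all add: xp_odd_def)
  then have "xp_x \<in> xp_span 1" "xp_p \<in> xp_span 1"
    by (auto simp: xp_span_def)
  then show ?case
    using xp_span_bracket_gen
    by (cases g) (simp_all add: xp_parity_def xp_x.abs_eq xp_p.abs_eq)
next
  case (homog_Zero a)
  have "xp_bracket 0 v = 0" for v
    using xp_bracket_scale_left[of 0 0 v] by simp
  then show ?case
    by (simp add: zero_xp_carrier.abs_eq[symmetric] xp_span_zero)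
next
  case (homog_Add a s t)
  then show ?case
    by (simp add: plus_xp_carrier.abs_eq[symmetric] xp_bracket_add_left xp_span_add)
next
  case (homog_Scale a t c)
  then show ?case
    by (simp add: xp_scale.abs_eq[symmetric] xp_bracket_scale_left xp_span_scale)
next
  case (homog_Br a s b t)
  let ?s = "abs_xp_carrier s" and ?t = "abs_xp_carrier t"
  have "xp_bracket (xp_bracket ?s ?t) v \<in> xp_span (a + b + d)" if v: "v \<in> xp_span d" for d v
  proof -
    have "xp_bracket ?s (xp_bracket ?t v) =
        xp_bracket (xp_bracket ?s ?t) v + xp_scale (koszul a b) (xp_bracket ?t (xp_bracket ?s v))"
      using homog_Br v xp_span_subset by (intro xp_bracket_jacobi) blast+
    then have "xp_bracket (xp_bracket ?s ?t) v = xp_bracket ?s (xp_bracket ?t v)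
        + xp_scale (- koszul a b) (xp_bracket ?t (xp_bracket ?s v))"
      by simp
    moreover have "xp_bracket ?s (xp_bracket ?t v) \<in> xp_span (a + (b + d))"
      "xp_bracket ?t (xp_bracket ?s v) \<in> xp_span (b + (a + d))"
      using homog_Br v by blast+
    moreover have "a + (b + d) = a + b + d" "b + (a + d) = a + b + d"
      by (simp_all only: add_ac)
    ultimately show ?thesis
      by (simp only: xp_span_add xp_span_scale)
  qed
  \<comment> \<open>That \<open>[s,t]\<close> itself lies in the span is the stability under
    \<open>s\<close> applied to \<open>t\<close>; this is why the induction carries both membership
    and stability.\<close>
  then show ?case
    using homog_Br unfolding xp_bracket.abs_eq[symmetric] by blast
qed

lemma xp_part_eq: "xp_part a = xp_span a"
  using homog_xp_span xp_span_subset unfolding xp_part_def by blast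

section \<open>The isomorphism\<close>

text \<open>
  With \<open>x = osp12_odd a 0\<close> and \<open>p = osp12_odd 0 b\<close>, both relations amount to \<open>a * b = - 2 * \<i>\<close>.
\<close>

definition xp_image :: "xp \<Rightarrow> complex ^ (1 + 2) ^ (1 + 2)" where
  "xp_image g = (case g of X \<Rightarrow> osp12_odd 1 0 | P \<Rightarrow> osp12_odd 0 (- 2 * \<i>))"

lemma xp_image_part: "xp_image g \<in> part osp12 (xp_parity g)"
  by (cases g) (simp_all add: xp_image_def xp_parity_def osp12_odd_in_part)

text \<open>By the universal property, well-definedness comes down to checking the two relations on
  matrices.\<close>

lift_definition xp_map :: "xp_carrier \<Rightarrow> complex ^ (1 + 2) ^ (1 + 2)"
  is "lterm_eval osp12 xp_image"
proof (rule lie_superalgebra.lterm_eval_lie_eq[OF lie_superalgebra_osp12 xp_image_part])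
  show "lterm_eval osp12 xp_image s = lterm_eval osp12 xp_image t"
    if "(s, t) \<in> xp_relations" for s t
    using that
    by (auto simp: xp_relations_def xp_image_def supercommutator_odd_odd
        supercommutator_even_odd osp12_odd_linear osp12_odd_eq_iff)
qed

lemma xp_map_simps:
  "xp_map (u + v) = xp_map u + xp_map v"
  "xp_map (xp_scale c u) = map_matrix ((*) c) (xp_map u)"
  "xp_map (xp_bracket u v) = supercommutator (xp_map u) (xp_map v)"
  "xp_map xp_x = osp12_odd 1 0"
  "xp_map xp_p = osp12_odd 0 (- 2 * \<i>)"
  by (transfer; simp add: xp_image_def)+

lemma xp_map_odd: "xp_map (xp_odd a b) = osp12_odd a (- 2 * \<i> * b)"
  by (simp add: xp_odd_def xp_map_simps osp12_odd_linear osp12_odd_eq_iff)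

text \<open>Up to their order, the coordinates are multiplied by nonzero constants, which gives both
  surjectivity and injectivity. The factor \<open>- 8\<close> is
  \<open>2 * (- 2 * \<i>)\<^sup>2\<close>.\<close>

lemma xp_map_even: "xp_map (xp_even a b c) = osp12_even (- 2 * \<i> * b) (- 2 * a) (- 8 * c)"
  by (simp add: xp_even_def xp_map_simps supercommutator_odd_odd osp12_even_linear
      osp12_even_eq_iff)

lemma xp_map_image_part: "xp_map ` xp_part a = osp12_part a"
proof
  show "xp_map ` xp_part a \<subseteq> osp12_part a"
    by (cases a)
      (auto simp: xp_part_eq xp_span_def xp_map_even xp_map_odd osp12_even_in_part
        osp12_odd_in_part)
  show "osp12_part a \<subseteq> xp_map ` xp_part a"
  proof (cases a)
    assume a: "a = 0"
    \<comment> \<open>The coefficients invert the factors in \<open>xp_map_even\<close>; the inverse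
      of \<open>- 2 * \<i>\<close> is \<open>\<i> / 2\<close>.\<close>
    have "osp12_even b c d = xp_map (xp_even (- c / 2) (\<i> * b / 2) (- d / 8))" for b c d
      by (simp add: xp_map_even osp12_even_eq_iff)
    then show ?thesis
      using xp_even_part by (auto simp only: a osp12_part_0 intro!: imageI)
  next
    assume a: "a = 1"
    have "osp12_odd b c = xp_map (xp_odd b (\<i> * c / 2))" for b c
      by (simp add: xp_map_odd osp12_odd_eq_iff)
    then show ?thesis
      using xp_odd_part by (auto simp only: a osp12_part_1 intro!: imageI)
  qed
qed

text \<open>Even and odd matrices have their nonzero entries in different positions, so the matrix
  determines all five coefficients. The argument does not presuppose that the decomposition of
  \<open>u\<close> into even and odd terms is unique.\<close>

lemma xp_map_inj: "inj_on xp_map (car xp_superalgebra)"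
proof
  fix u v
  assume "u \<in> car xp_superalgebra" "v \<in> car xp_superalgebra" and eq: "xp_map u = xp_map v"
  then obtain a b c d e a' b' c' d' e' where uv: "u = xp_even a b c + xp_odd d e"
      "v = xp_even a' b' c' + xp_odd d' e'"
    by (auto simp: car_def xp_part_eq xp_span_def)
  show "u = v"
    using eq
    by (auto simp: uv xp_map_simps xp_map_odd xp_map_even vec_eq_iff forall_index12
        osp12_odd_def osp12_even_def)
qed

lemma lie_superalgebra_xp: "lie_superalgebra xp_superalgebra"
proof (rule lie_superalgebra.intro)
  show "vector_space (scl xp_superalgebra)"
    by (simp add: xp.vector_space_axioms)
  show "module.subspace (scl xp_superalgebra) (xp_part a)" for a
    by (simp add: xp.subspace_def xp_part_zero xp_part_add xp_part_scale)
  have "u = 0" if u: "u \<in> xp_part 0" "u \<in> xp_part 1" for u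
  proof -
    have "u + 0 \<in> car xp_superalgebra" "0 + 0 \<in> car xp_superalgebra"
      using u(1) xp_part_zero unfolding car_def by blast+
    \<comment> \<open>The image is both an even and an odd matrix, hence zero; injectivity then
      carries this back to \<open>u\<close>.\<close>
    moreover have "xp_map u = 0"
      using u xp_map_image_part by (intro gl_part_Int osp12_part_gl) blast+
    moreover have "xp_map 0 = 0"
      by transfer simp
    ultimately show ?thesis
      using inj_onD[OF xp_map_inj, of u 0] by simp
  qed
  then show "xp_part 0 \<inter> xp_part 1 = {0}"
    using xp_part_zero by auto
qed (unfold xp_simps, (rule xp_bracket_add_left xp_bracket_add_right xp_bracket_scale_left
    xp_bracket_scale_right xp_part_bracket xp_bracket_skew xp_bracket_jacobi; assumption)+)

lemma lie_superalgebra_iso_xp_map: "lie_superalgebra_iso xp_superalgebra osp12 xp_map"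
proof -
  have "xp_map ` car xp_superalgebra = car osp12"
  proof (intro subset_antisym subsetI)
    fix M
    assume "M \<in> xp_map ` car xp_superalgebra"
    then show "M \<in> car osp12"
      using xp_map_image_part by (fastforce simp: car_def xp_map_simps)
  next
    fix M
    assume "M \<in> car osp12"
    then obtain u v where "u \<in> xp_part 0" "v \<in> xp_part 1" "M = xp_map (u + v)"
      by (auto simp: car_def xp_map_simps xp_map_image_part[symmetric])
    then show "M \<in> xp_map ` car xp_superalgebra"
      by (auto simp: car_def)
  qed
  then show ?thesis
    by (simp add: lie_superalgebra_iso_def bij_betw_def xp_map_inj xp_map_image_part xp_map_simps)
qed

theorem proposition1:
  shows "isomorphic_lie_superalgebras xp_superalgebra osp12"
  unfolding isomorphic_lie_superalgebras_def
  using lie_superalgebra_xp lie_superalgebra_osp12 lie_superalgebra_iso_xp_map by blast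

end
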